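(* Let $M>0$. Suppose there exist $\epsilon_k>0$ with $\epsilon_k\to0$ as $k\to+\infty$ and $Z_{1\epsilon_k}\in\Omega_M$ with $Z_{1\epsilon_k}=T_{0\epsilon_k}(Z_{1\epsilon_k})$, $k\ge1$, such that for every $c>0$ there exists $d>0$ such that for all $k,l$ and all $1\le i\le9m$, $$m\big(\Omega_{k,l,i}^{+}(d)\cup\Omega_{k,l,i}^{-}(d)\big)\le c ,$$ where $m(\cdot)$ on sets is Lebesgue measure and $$\Omega_{k,l,i}^{+}=\{X\in\overline\Omega: Z_{1,i,\epsilon_k}-Z_{1,i,\epsilon_l}\ge0\},\qquad \Omega_{k,l,i}^{-}=\{X\in\overline\Omega: Z_{1,i,\epsilon_k}-Z_{1,i,\epsilon_l}<0\},$$ $$\Omega_{k,l,i}^{\pm}(d)=\{X\in\overline\Omega:\operatorname{dist}(X,\partial\Omega_{k,l,i}^{\pm})\le d\}.$$ Then the following holds: there exist $\epsilon_k'>0$ and $Z_{1\epsilon_k'}\in\Omega_M$ with $Z_{1\epsilon_k'}=T_{0\epsilon_k'}(Z_{1\epsilon_k'})$, $k\ge1$, such that $\lim_{k\to+\infty}\epsilon_k'=0$ and $\lim_{k\to+\infty}Z_{1\epsilon_k'}$ exists almost everywhere on $\overline\Omega$.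
   Context: **Setting.** $\Omega\subset\mathbb R^3$ is a bounded domain with $\partial\Omega\in C^{1,\alpha}$ ($0<\alpha\le1$) and $\overline\Omega$ convex; $m$ is a positive integer; $n=(n_1,n_2,n_3)$ is the unit exterior normal on $\partial\Omega$; $I_{\overline\Omega}$ is the characteristic function of $\overline\Omega$. A Dirichlet datum $A_1=u|_{\partial\Omega}\in C^2(\partial\Omega;\mathbb R^m)$ is given. For $u\in C^2(\overline\Omega;\mathbb R^m)$, $v_1,\dots,v_{10m}$ is a fixed permutation of the $10m$ scalar components of $u,u_x,u_y,u_z,u_{xx},u_{xy},u_{xz},u_{yy},u_{yz},u_{zz}$; the system is $v_j=f_j(v_{m+1},\dots,v_{10m},x,y,z)$, $1\le j\le m$, with $f=(f_1,\dots,f_m)^T$ continuous. **Matrices.** $C\in\mathbb R^{m\times 9m}$ is a constant matrix, $E$ the identity of order $m$, $\beta^T=(C,E)$, $e_k$ the $k$-th unit vector of $\mathbb R^{10m}$. The $m\times10m$ matrices $A_0,A_{01},A_{02},A_{03},A_{11},A_{12},A_{13},A_{22},A_{23},A_{33}$ correspond to $u,u_x,u_y,u_z,u_{xx},u_{xy},u_{xz},u_{yy},u_{yz},u_{zz}$: the row corresponding to the scalar component which is $v_j$ is the $j$-th row of $\beta^T$ if $j\le m$, and $e_{j-m}^T$ if $j>m$. $B(\xi)$ is the $9m\times10m$ matrix with block rows $i\xi_kA_0-A_{0k}$ ($k=1,2,3$) followed by $i\xi_ji\xi_kA_0-A_{jk}$ for $(j,k)=(1,1),(1,2),(1,3),(2,2),(2,3),(3,3)$;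 $B=(B_1,-B_2)$ with $B_1$ the first $9m$ columns. $C$ is chosen so that $\det B_1\not\equiv0$ and there is a polynomial $a_1$ in $i\xi_1,i\xi_2,i\xi_3$ with: $F^{-1}(a_1^{-1})\in\mathcal S'(\mathbb R^3)$ locally integrable; $a_1B_1^{-1}$ a polynomial matrix; $\varphi*F^{-1}(a_1^{-1})\in C(\mathbb R^3)$ for all Schwartz $\varphi$; and $(1+|\xi|^2)^{-a-3}B_1^{-1},\ (1+|\xi|^2)^{-a-3}B_1^{-1}B_2\in L^1(\mathbb R^3)$, where $a$ is the highest degree of the entries of $a_1B_1^{-1}$ and $a_1B_1^{-1}B_2$. $F(\phi)(\xi)=\int\phi(X)e^{-i\xi\cdot X}dX$. **$\psi,\psi_1$.** $\psi(Z_1)=f(Z_1,x,y,z)-CZ_1$. $\psi_1(Z_1)$ is the continuous function of $Z_1$ (and $x,y,z$) obtained from $-\Delta u=-(u_{xx}+u_{yy}+u_{zz})$ by replacing each scalar component that is $v_j$, $j\le m$, by $f_j(Z_1,x,y,z)$, and each that is $v_{m+k}$ by the $k$-th component of $Z_1$. **Boundary terms.** Let $h(X)=\frac1{4\pi|X|}$, and for $P_0\in\partial\Omega$ let $g_{02}(P_0)$ be the limit, as $M\to P_0$ along the normal line at $P_0$ from inside $\Omega$, of the derivative in direction $n_{P_0}$ of $M\mapsto\int_{\partial\Omega}[\nabla_Mh(M-P_1)\cdot n_{P_1}]A_1(P_1)dS_{P_1}$ (assumed to exist and belong to $C^1(\partial\Omega)$). $A_5=A_5(Z_1)$ is the unique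 solution on $\partial\Omega$ of $$\tfrac12A_5(P_0)=\int_{\partial\Omega}[\nabla h(P_0-P_1)\cdot n_{P_0}]A_5(P_1)dS_{P_1}+g_{02}(P_0)+\int_\Omega[\nabla h(P_0-Y)\cdot n_{P_0}]\psi_1(Z_1)(Y)dY .$$ Put $A_2=\partial_xA_1+(A_5-\partial_nA_1)n_1$, $A_3=\partial_yA_1+(A_5-\partial_nA_1)n_2$, $A_4=\partial_zA_1+(A_5-\partial_nA_1)n_3$ (with any $C^1$ extension of $A_1$ near $\partial\Omega$). Set $g_j=\int_{\partial\Omega}A_1n_je^{-i\xi\cdot X}dS$ ($j=1,2,3$), $g_{11},g_{21},g_{31}=\int_{\partial\Omega}A_kn_1e^{-i\xi\cdot X}dS$ with $k=2,3,4$ respectively, $g_{22},g_{32}=\int_{\partial\Omega}A_kn_2e^{-i\xi\cdot X}dS$ with $k=3,4$ respectively, $g_{33}=\int_{\partial\Omega}A_4n_3e^{-i\xi\cdot X}dS$, and $\beta_1=(-g_1^T,-g_2^T,-g_3^T,-g_{11}^T-i\xi_1g_1^T,-g_{21}^T-i\xi_1g_2^T,-g_{31}^T-i\xi_1g_3^T,-g_{22}^T-i\xi_2g_2^T,-g_{32}^T-i\xi_2g_3^T,-g_{33}^T-i\xi_3g_3^T)^T$. **Operators.** For $\epsilon>0$ let $\delta_\epsilon(X)=(\pi\epsilon)^{-3/2}e^{-|X|^2/\epsilon}$ and $T_{0\epsilon}(Z_1)=F^{-1}(F(\delta_\epsilon)B_1^{-1}\beta_1)+F^{-1}(F(\delta_\epsilon)B_1^{-1}B_2)*(\psi(Z_1)I_{\overline\Omega})$,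 regarded as an operator on $C(\overline\Omega;\mathbb R^{9m})$ by restriction to $\overline\Omega$. **Notation.** $\|Z_1\|_\infty=\max_{1\le i\le9m}\max_{X\in\overline\Omega}|Z_{1,i}(X)|$; $\Omega_M=\{Z_1\in C(\overline\Omega;\mathbb R^{9m}):\|Z_1\|_\infty<M\}$; $Z_{1,i,\epsilon_k}$ is the $i$-th component of $Z_{1\epsilon_k}$; the distance to the empty set is $+\infty$. *)

theory Defs
  imports "HOL-Analysis.Analysis" "HOL-Library.Poly_Mapping"
begin

definition dir_deriv :: "real^3 \<Rightarrow> (real^3 \<Rightarrow> 'b::real_normed_vector) \<Rightarrow> real^3 \<Rightarrow> 'b" where
  "dir_deriv e f X = vector_derivative (\<lambda>t. f (X + t *\<^sub>R e)) (at 0)"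

definition partial :: "3 \<Rightarrow> (real^3 \<Rightarrow> 'b::real_normed_vector) \<Rightarrow> real^3 \<Rightarrow> 'b" where
  "partial k f = dir_deriv (axis k 1) f"

definition grad :: "(real^3 \<Rightarrow> real) \<Rightarrow> real^3 \<Rightarrow> real^3" where
  "grad f X = (\<chi> k. partial k f X)"

text \<open>\<open>Ck_on k U f\<close> is meant for open \<open>U\<close>: the function \<open>f\<close> is of class $C^k$ on \<open>U\<close>.\<close>

fun Ck_on :: "nat \<Rightarrow> (real^3) set \<Rightarrow> (real^3 \<Rightarrow> 'b::real_normed_vector) \<Rightarrow> bool" where
  "Ck_on 0 U f = continuous_on U f"
| "Ck_on (Suc k) U f = ((\<forall>X\<in>U. f differentiable (at X)) \<and> (\<forall>j. Ck_on k U (partial j f)))"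

definition Ck_extension :: "nat \<Rightarrow> (real^3) set \<Rightarrow> (real^3 \<Rightarrow> 'b::real_normed_vector) \<Rightarrow>
    (real^3 \<Rightarrow> 'b) \<Rightarrow> bool" where
  "Ck_extension k S g e \<longleftrightarrow> (\<exists>U. open U \<and> S \<subseteq> U \<and> Ck_on k U e) \<and> (\<forall>X\<in>S. e X = g X)"

text \<open>$C^k(S)$ for a closed surface \<open>S\<close>: restrictions to \<open>S\<close> of functions of class $C^k$ near \<open>S\<close>.
  Values of \<open>g\<close> off \<open>S\<close> are irrelevant.\<close>

definition Ck_surface :: "nat \<Rightarrow> (real^3) set \<Rightarrow> (real^3 \<Rightarrow> 'b::real_normed_vector) \<Rightarrow> bool" where
  "Ck_surface k S g \<longleftrightarrow> (\<exists>e. Ck_extension k S g e)"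

definition C1_holder :: "real \<Rightarrow> (real^2 \<Rightarrow> real) \<Rightarrow> bool" where
  "C1_holder \<alpha> \<gamma> \<longleftrightarrow>
     (\<exists>G::real^2 \<Rightarrow> real^2. (\<forall>y. (\<gamma> has_derivative (\<lambda>h. G y \<bullet> h)) (at y)) \<and>
        (\<exists>L. \<forall>y z. norm (G y - G z) \<le> L * norm (y - z) powr \<alpha>))"

text \<open>Near each boundary point, in suitable Cartesian coordinates, the domain is the part above the
  graph of a $C^{1,\alpha}$ function. Asking for a globally defined \<open>\<gamma>\<close> is no restriction, since a
  local one can be cut off.\<close>

definition C1_holder_boundary :: "real \<Rightarrow> (real^3) set \<Rightarrow> bool" where
  "C1_holder_boundary \<alpha> \<Omega> \<longleftrightarrow>
     (\<forall>P\<in>frontier \<Omega>. \<exists>(R::real^3^3) r \<gamma>. orthogonal_matrix R \<and> r > 0 \<and> C1_holder \<alpha> \<gamma> \<and>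
        \<Omega> \<inter> ball P r =
          {X \<in> ball P r. \<gamma> (vector [(R *v (X - P)) $ 1, (R *v (X - P)) $ 2]) < (R *v (X - P)) $ 3})"

text \<open>The unit vector orthogonal to the tangent plane at \<open>P\<close> that points out of the domain.\<close>

definition outer_normal :: "(real^3) set \<Rightarrow> real^3 \<Rightarrow> real^3" where
  "outer_normal \<Omega> P = (THE \<nu>. norm \<nu> = 1 \<and>
     ((\<lambda>X. ((X - P) \<bullet> \<nu>) / norm (X - P)) \<longlongrightarrow> 0) (at P within frontier \<Omega>) \<and>
     (\<forall>\<^sub>F t in at_right 0. P - t *\<^sub>R \<nu> \<in> \<Omega> \<and> P + t *\<^sub>R \<nu> \<notin> closure \<Omega>))"

text \<open>Surface measure is two-dimensional Hausdorff measure, normalised to agree with area.\<close>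

definition hausdorff2_pre :: "real \<Rightarrow> (real^3) set \<Rightarrow> ennreal" where
  "hausdorff2_pre \<delta> A =
     (INF U\<in>{U::nat \<Rightarrow> (real^3) set. A \<subseteq> (\<Union>i. U i) \<and> (\<forall>i. bounded (U i) \<and> diameter (U i) \<le> \<delta>)}.
        suminf (\<lambda>i. ennreal (pi * (diameter (U i) / 2)^2)))"

definition hausdorff2 :: "(real^3) set \<Rightarrow> ennreal" where
  "hausdorff2 A = (SUP \<delta>\<in>{0<..}. hausdorff2_pre \<delta> A)"

definition surface_measure :: "(real^3) measure" where
  "surface_measure = measure_of UNIV (sets borel) hausdorff2"

definition fourier :: "(real^3 \<Rightarrow> complex) \<Rightarrow> real^3 \<Rightarrow> complex" where
  "fourier \<phi> \<xi> = (\<integral>X. \<phi> X * exp (- \<i> * complex_of_real (\<xi> \<bullet> X)) \<partial>lborel)"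

definition inv_fourier :: "(real^3 \<Rightarrow> complex) \<Rightarrow> real^3 \<Rightarrow> complex" where
  "inv_fourier \<phi> X =
     complex_of_real (1 / (2 * pi)^3) * (\<integral>\<xi>. \<phi> \<xi> * exp (\<i> * complex_of_real (\<xi> \<bullet> X)) \<partial>lborel)"

definition smooth :: "(real^3 \<Rightarrow> complex) \<Rightarrow> bool" where
  "smooth \<phi> \<longleftrightarrow> (\<forall>k. Ck_on k UNIV \<phi>)"

definition schwartz :: "(real^3 \<Rightarrow> complex) set" where
  "schwartz = {\<phi>. smooth \<phi> \<and>
     (\<forall>N ks. bounded (range (\<lambda>X. (1 + norm X)^N *\<^sub>R fold partial ks \<phi> X)))}"

definition test_function :: "(real^3 \<Rightarrow> complex) set" where
  "test_function = {\<phi>. smooth \<phi> \<and> (\<exists>R. \<forall>X. norm X > R \<longrightarrow> \<phi> X = 0)}"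

definition schwartz_norm :: "nat \<Rightarrow> (real^3 \<Rightarrow> complex) \<Rightarrow> real" where
  "schwartz_norm N \<phi> =
     (SUP (ks, X)\<in>{ks. length ks \<le> N} \<times> UNIV. (1 + norm X)^N * norm (fold partial ks \<phi> X))"

text \<open>The space $\mathcal S'$; only the values of \<open>T\<close> on Schwartz functions matter.\<close>

definition tempered :: "((real^3 \<Rightarrow> complex) \<Rightarrow> complex) \<Rightarrow> bool" where
  "tempered T \<longleftrightarrow>
     (\<forall>\<phi>\<in>schwartz. \<forall>\<theta>\<in>schwartz. T (\<lambda>X. \<phi> X + \<theta> X) = T \<phi> + T \<theta>) \<and>
     (\<forall>\<phi>\<in>schwartz. \<forall>c. T (\<lambda>X. c * \<phi> X) = c * T \<phi>) \<and>
     (\<exists>N K. \<forall>\<phi>\<in>schwartz. norm (T \<phi>) \<le> K * schwartz_norm N \<phi>)"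

definition inv_fourier_dist ::
  "((real^3 \<Rightarrow> complex) \<Rightarrow> complex) \<Rightarrow> (real^3 \<Rightarrow> complex) \<Rightarrow> complex" where
  "inv_fourier_dist T \<phi> = T (inv_fourier \<phi>)"

definition loc_integrable_dist :: "((real^3 \<Rightarrow> complex) \<Rightarrow> complex) \<Rightarrow> bool" where
  "loc_integrable_dist T \<longleftrightarrow>
     (\<exists>G::real^3 \<Rightarrow> complex. (\<forall>K. compact K \<longrightarrow> set_integrable lborel K G) \<and>
        (\<forall>\<phi>\<in>test_function. T \<phi> = (\<integral>X. G X * \<phi> X \<partial>lborel)))"

definition conv_dist ::
  "(real^3 \<Rightarrow> complex) \<Rightarrow> ((real^3 \<Rightarrow> complex) \<Rightarrow> complex) \<Rightarrow> real^3 \<Rightarrow> complex" where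
  "conv_dist \<phi> T X = T (\<lambda>Y. \<phi> (X - Y))"

text \<open>Polynomials in $i\xi_1, i\xi_2, i\xi_3$, as finitely supported families of coefficients indexed by
  exponent vectors.\<close>

type_synonym poly3 = "(3 \<Rightarrow>\<^sub>0 nat) \<Rightarrow>\<^sub>0 complex"

definition peval :: "poly3 \<Rightarrow> real^3 \<Rightarrow> complex" where
  "peval p \<xi> = (\<Sum>\<nu>\<in>Poly_Mapping.keys p. Poly_Mapping.lookup p \<nu> *
     (\<Prod>k\<in>UNIV. (\<i> * complex_of_real (\<xi> $ k)) ^ Poly_Mapping.lookup \<nu> k))"

definition pdegree :: "poly3 \<Rightarrow> nat" where
  "pdegree p = Max (insert 0 ((\<lambda>\<nu>. \<Sum>k\<in>UNIV. Poly_Mapping.lookup \<nu> k) ` Poly_Mapping.keys p))"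

text \<open>\<open>recip_dist p T\<close>: the tempered distribution \<open>T\<close> is an inverse $p^{-1}$ of \<open>p\<close>, i.e. $p\,T = 1$ in
  $\mathcal S'$. (Where \<open>p\<close> is nonzero, \<open>T\<close> is then the function $1/p$. This covers the case of a
  locally integrable $1/p$ of tempered growth acting by integration.)\<close>

definition recip_dist :: "poly3 \<Rightarrow> ((real^3 \<Rightarrow> complex) \<Rightarrow> complex) \<Rightarrow> bool" where
  "recip_dist p T \<longleftrightarrow> tempered T \<and>
     (\<forall>\<phi>\<in>schwartz. T (\<lambda>\<xi>. peval p \<xi> * \<phi> \<xi>) = (\<integral>\<xi>. \<phi> \<xi> \<partial>lborel))"

datatype dv = Dx | Dy | Dz | Dxx | Dxy | Dxz | Dyy | Dyz | Dzz

instance dv :: finite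
proof
  have "(UNIV :: dv set) = {Dx, Dy, Dz, Dxx, Dxy, Dxz, Dyy, Dyz, Dzz}"
    using dv.exhaust by auto
  then show "finite (UNIV :: dv set)"
    by (metis finite.emptyI finite.insertI)
qed

text \<open>The finite type \<open>'m\<close> has \<open>m\<close> elements. The 10m scalar components of
  $u, u_x, \ldots, u_{zz}$ are labelled by \<open>'m jet\<close>: \<open>(None, i)\<close> is $u_i$ and \<open>(Some Dxy, i)\<close> is
  $(u_i)_{xy}$, etc. The type \<open>'m idx\<close> has 9m elements. It labels the block rows of $B$ and, as a mere
  set of 9m labels, also the positions $m+1,\ldots,10m$ in the list $v_1,\ldots,v_{10m}$, i.e. the
  entries of $Z_1$. The permutation is a bijection \<open>\<sigma>\<close> from \<open>'m jet\<close> onto \<open>'m + 'm idx\<close>: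
  \<open>\<sigma> c = Inl j\<close> means that \<open>c\<close> is $v_j$ with $j \le m$, and \<open>\<sigma> c = Inr k\<close> that \<open>c\<close> is
  $v_{m+k}$. Vectors with 10m entries are split as \<open>'m idx + 'm\<close>, the first 9m entries
  and the last m.\<close>

type_synonym 'm jet = "dv option \<times> 'm"
type_synonym 'm idx = "dv \<times> 'm"
type_synonym 'm numbering = "'m jet \<Rightarrow> 'm + 'm idx"

definition betaT :: "real^('m::finite idx)^'m \<Rightarrow> real^('m idx + 'm)^'m" where
  "betaT C = (\<chi> j c. case c of Inl k \<Rightarrow> C $ j $ k | Inr l \<Rightarrow> (mat 1 :: real^'m^'m) $ j $ l)"

definition Amat :: "'m::finite numbering \<Rightarrow> real^('m idx)^'m \<Rightarrow> dv option \<Rightarrow> real^('m idx + 'm)^'m" where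
  "Amat \<sigma> C s = (\<chi> i. case \<sigma> (s, i) of Inl j \<Rightarrow> betaT C $ j | Inr k \<Rightarrow> axis (Inl k) 1)"

definition ixi :: "real^3 \<Rightarrow> 3 \<Rightarrow> complex" where
  "ixi \<xi> k = \<i> * complex_of_real (\<xi> $ k)"

fun dsymbol :: "real^3 \<Rightarrow> dv \<Rightarrow> complex" where
  "dsymbol \<xi> Dx = ixi \<xi> 1"
| "dsymbol \<xi> Dy = ixi \<xi> 2"
| "dsymbol \<xi> Dz = ixi \<xi> 3"
| "dsymbol \<xi> Dxx = ixi \<xi> 1 * ixi \<xi> 1"
| "dsymbol \<xi> Dxy = ixi \<xi> 1 * ixi \<xi> 2"
| "dsymbol \<xi> Dxz = ixi \<xi> 1 * ixi \<xi> 3"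
| "dsymbol \<xi> Dyy = ixi \<xi> 2 * ixi \<xi> 2"
| "dsymbol \<xi> Dyz = ixi \<xi> 2 * ixi \<xi> 3"
| "dsymbol \<xi> Dzz = ixi \<xi> 3 * ixi \<xi> 3"

definition Bmat :: "'m::finite numbering \<Rightarrow> real^('m idx)^'m \<Rightarrow> real^3 \<Rightarrow> complex^('m idx + 'm)^('m idx)" where
  "Bmat \<sigma> C \<xi> = (\<chi> r c. dsymbol \<xi> (fst r) * complex_of_real (Amat \<sigma> C None $ snd r $ c)
                        - complex_of_real (Amat \<sigma> C (Some (fst r)) $ snd r $ c))"

definition B1 :: "'m::finite numbering \<Rightarrow> real^('m idx)^'m \<Rightarrow> real^3 \<Rightarrow> complex^('m idx)^('m idx)" where
  "B1 \<sigma> C \<xi> = (\<chi> r k. Bmat \<sigma> C \<xi> $ r $ Inl k)"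

definition B2 :: "'m::finite numbering \<Rightarrow> real^('m idx)^'m \<Rightarrow> real^3 \<Rightarrow> complex^'m^('m idx)" where
  "B2 \<sigma> C \<xi> = (\<chi> r j. - Bmat \<sigma> C \<xi> $ r $ Inr j)"

abbreviation B1inv :: "'m::finite numbering \<Rightarrow> real^('m idx)^'m \<Rightarrow> real^3 \<Rightarrow> complex^('m idx)^('m idx)" where
  "B1inv \<sigma> C \<xi> \<equiv> matrix_inv (B1 \<sigma> C \<xi>)"

text \<open>The requirements on the constant matrix \<open>C\<close>. The identities between rational matrices are
  required at the points where $B_1(\xi)$ is invertible; the remaining points form a null set, where
  the value of \<^const>\<open>matrix_inv\<close> is irrelevant. The matrices \<open>P\<close> and \<open>Q\<close> are
  $a_1B_1^{-1}$ and $a_1B_1^{-1}B_2$, and \<open>T\<close> is $a_1^{-1}$.\<close>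

definition admissible_C :: "'m::finite numbering \<Rightarrow> real^('m idx)^'m \<Rightarrow> bool" where
  "admissible_C \<sigma> C \<longleftrightarrow>
     (\<exists>\<xi>. det (B1 \<sigma> C \<xi>) \<noteq> 0) \<and>
     (\<exists>(a1::poly3) T (P::poly3^('m idx)^('m idx)) (Q::poly3^'m^('m idx)) (a::nat).
        recip_dist a1 T \<and>
        loc_integrable_dist (inv_fourier_dist T) \<and>
        (\<forall>\<phi>\<in>schwartz. continuous_on UNIV (conv_dist \<phi> (inv_fourier_dist T))) \<and>
        (\<forall>\<xi>. det (B1 \<sigma> C \<xi>) \<noteq> 0 \<longrightarrow>
           (\<forall>r k. peval a1 \<xi> * B1inv \<sigma> C \<xi> $ r $ k = peval (P $ r $ k) \<xi>) \<and>
           (\<forall>r j. peval a1 \<xi> * (B1inv \<sigma> C \<xi> ** B2 \<sigma> C \<xi>) $ r $ j = peval (Q $ r $ j) \<xi>)) \<and>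
        a = Max ({pdegree (P $ r $ k) |r k. True} \<union> {pdegree (Q $ r $ j) |r j. True}) \<and>
        (\<forall>r k. integrable lborel (\<lambda>\<xi>.
           complex_of_real ((1 + (norm \<xi>)\<^sup>2) powr (- real a - 3)) * B1inv \<sigma> C \<xi> $ r $ k)) \<and>
        (\<forall>r j. integrable lborel (\<lambda>\<xi>.
           complex_of_real ((1 + (norm \<xi>)\<^sup>2) powr (- real a - 3)) * (B1inv \<sigma> C \<xi> ** B2 \<sigma> C \<xi>) $ r $ j)))"

text \<open>The right-hand side \<open>f\<close> of the system takes $(v_{m+1},\ldots,v_{10m})$ and the point $(x,y,z)$.
  Functions on \<open>closure \<Omega>\<close> (such as \<open>Z\<close>) are total functions whose other values are irrelevant.\<close>

definition psi :: "real^('m::finite idx)^'m \<Rightarrow> (real^('m idx) \<Rightarrow> real^3 \<Rightarrow> real^'m) \<Rightarrow>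
    (real^3 \<Rightarrow> real^('m idx)) \<Rightarrow> real^3 \<Rightarrow> real^'m" where
  "psi C f Z X = f (Z X) X - C *v Z X"

definition jet_value :: "'m::finite numbering \<Rightarrow> (real^('m idx) \<Rightarrow> real^3 \<Rightarrow> real^'m) \<Rightarrow>
    (real^3 \<Rightarrow> real^('m idx)) \<Rightarrow> real^3 \<Rightarrow> 'm jet \<Rightarrow> real" where
  "jet_value \<sigma> f Z X c = (case \<sigma> c of Inl j \<Rightarrow> f (Z X) X $ j | Inr k \<Rightarrow> Z X $ k)"

definition psi1 :: "'m::finite numbering \<Rightarrow> (real^('m idx) \<Rightarrow> real^3 \<Rightarrow> real^'m) \<Rightarrow>
    (real^3 \<Rightarrow> real^('m idx)) \<Rightarrow> real^3 \<Rightarrow> real^'m" where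
  "psi1 \<sigma> f Z X = (\<chi> i. - (jet_value \<sigma> f Z X (Some Dxx, i) + jet_value \<sigma> f Z X (Some Dyy, i)
                          + jet_value \<sigma> f Z X (Some Dzz, i)))"

definition newton :: "real^3 \<Rightarrow> real" where
  "newton X = 1 / (4 * pi * norm X)"

definition double_layer :: "(real^3) set \<Rightarrow> (real^3 \<Rightarrow> real^'m::finite) \<Rightarrow> real^3 \<Rightarrow> real^'m" where
  "double_layer \<Omega> A1 M =
     (LINT P1:frontier \<Omega>|surface_measure. (grad newton (M - P1) \<bullet> outer_normal \<Omega> P1) *\<^sub>R A1 P1)"

text \<open>The normal derivative of the double layer potential at the point of the normal line at
  distance \<open>t\<close> from \<open>P0\<close>, inside \<open>\<Omega>\<close> for small positive \<open>t\<close>.\<close>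

definition inner_normal_deriv :: "(real^3) set \<Rightarrow> (real^3 \<Rightarrow> real^'m::finite) \<Rightarrow> real^3 \<Rightarrow> real \<Rightarrow> real^'m" where
  "inner_normal_deriv \<Omega> A1 P0 t =
     dir_deriv (outer_normal \<Omega> P0) (double_layer \<Omega> A1) (P0 - t *\<^sub>R outer_normal \<Omega> P0)"

definition g02 :: "(real^3) set \<Rightarrow> (real^3 \<Rightarrow> real^'m::finite) \<Rightarrow> real^3 \<Rightarrow> real^'m" where
  "g02 \<Omega> A1 P0 = Lim (at_right 0) (inner_normal_deriv \<Omega> A1 P0)"

text \<open>The unique solution in $C(\partial\Omega)$, extended by zero off $\partial\Omega$ so that the
  description is unique as a total function.\<close>

definition A5 :: "(real^3) set \<Rightarrow> 'm::finite numbering \<Rightarrow> (real^('m idx) \<Rightarrow> real^3 \<Rightarrow> real^'m) \<Rightarrow>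
    (real^3 \<Rightarrow> real^'m) \<Rightarrow> (real^3 \<Rightarrow> real^('m idx)) \<Rightarrow> real^3 \<Rightarrow> real^'m" where
  "A5 \<Omega> \<sigma> f A1 Z = (THE w. continuous_on (frontier \<Omega>) w \<and> (\<forall>P. P \<notin> frontier \<Omega> \<longrightarrow> w P = 0) \<and>
     (\<forall>P0\<in>frontier \<Omega>. (1/2) *\<^sub>R w P0 =
        (LINT P1:frontier \<Omega>|surface_measure. (grad newton (P0 - P1) \<bullet> outer_normal \<Omega> P0) *\<^sub>R w P1)
        + g02 \<Omega> A1 P0
        + (LINT Y:\<Omega>|lborel. (grad newton (P0 - Y) \<bullet> outer_normal \<Omega> P0) *\<^sub>R psi1 \<sigma> f Z Y)))"

text \<open>\<open>Agrad \<Omega> Ae w k\<close> for \<open>k = 1, 2, 3\<close> is $A_2, A_3, A_4$, where \<open>Ae\<close> is a $C^1$ extension of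
  $A_1$ and \<open>w\<close> is $A_5$.\<close>

definition Agrad :: "(real^3) set \<Rightarrow> (real^3 \<Rightarrow> real^'m::finite) \<Rightarrow> (real^3 \<Rightarrow> real^'m) \<Rightarrow> 3 \<Rightarrow> real^3 \<Rightarrow> real^'m" where
  "Agrad \<Omega> Ae w k P =
     partial k Ae P + (outer_normal \<Omega> P $ k) *\<^sub>R (w P - dir_deriv (outer_normal \<Omega> P) Ae P)"

definition bdry_fourier :: "(real^3) set \<Rightarrow> (real^3 \<Rightarrow> real^'m::finite) \<Rightarrow> 3 \<Rightarrow> real^3 \<Rightarrow> complex^'m" where
  "bdry_fourier \<Omega> A j \<xi> = (\<chi> i. LINT X:frontier \<Omega>|surface_measure.
     complex_of_real (A X $ i * outer_normal \<Omega> X $ j) * exp (- \<i> * complex_of_real (\<xi> \<bullet> X)))"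

definition beta1 :: "(real^3) set \<Rightarrow> (real^3 \<Rightarrow> real^'m::finite) \<Rightarrow> (real^3 \<Rightarrow> real^'m) \<Rightarrow> (real^3 \<Rightarrow> real^'m) \<Rightarrow>
    real^3 \<Rightarrow> complex^('m idx)" where
  "beta1 \<Omega> A1 Ae w \<xi> =
     (let g = (\<lambda>j. bdry_fourier \<Omega> A1 j \<xi>);
          g2 = (\<lambda>k j. bdry_fourier \<Omega> (Agrad \<Omega> Ae w k) j \<xi>)
      in \<chi> r. (case fst r of
           Dx \<Rightarrow> - g 1
         | Dy \<Rightarrow> - g 2
         | Dz \<Rightarrow> - g 3
         | Dxx \<Rightarrow> - g2 1 1 - ixi \<xi> 1 *s g 1
         | Dxy \<Rightarrow> - g2 2 1 - ixi \<xi> 1 *s g 2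
         | Dxz \<Rightarrow> - g2 3 1 - ixi \<xi> 1 *s g 3
         | Dyy \<Rightarrow> - g2 2 2 - ixi \<xi> 2 *s g 2
         | Dyz \<Rightarrow> - g2 3 2 - ixi \<xi> 2 *s g 3
         | Dzz \<Rightarrow> - g2 3 3 - ixi \<xi> 3 *s g 3) $ snd r)"

definition delta_eps :: "real \<Rightarrow> real^3 \<Rightarrow> real" where
  "delta_eps \<epsilon> X = (pi * \<epsilon>) powr (-3/2) * exp (- (norm X)\<^sup>2 / \<epsilon>)"

definition T0 :: "(real^3) set \<Rightarrow> 'm::finite numbering \<Rightarrow> real^('m idx)^'m \<Rightarrow>
    (real^('m idx) \<Rightarrow> real^3 \<Rightarrow> real^'m) \<Rightarrow> (real^3 \<Rightarrow> real^'m) \<Rightarrow> (real^3 \<Rightarrow> real^'m) \<Rightarrow>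
    real \<Rightarrow> (real^3 \<Rightarrow> real^('m idx)) \<Rightarrow> real^3 \<Rightarrow> complex^('m idx)" where
  "T0 \<Omega> \<sigma> C f A1 Ae \<epsilon> Z X =
     (let F\<delta> = fourier (\<lambda>Y. complex_of_real (delta_eps \<epsilon> Y));
          K = (\<lambda>r j. inv_fourier (\<lambda>\<xi>. F\<delta> \<xi> * (B1inv \<sigma> C \<xi> ** B2 \<sigma> C \<xi>) $ r $ j))
      in \<chi> r. inv_fourier (\<lambda>\<xi>. F\<delta> \<xi> * (B1inv \<sigma> C \<xi> *v beta1 \<Omega> A1 Ae (A5 \<Omega> \<sigma> f A1 Z) \<xi>) $ r) X
            + (\<integral>Y. (\<Sum>j\<in>UNIV. K r j (X - Y) *
                 complex_of_real (indicator (closure \<Omega>) Y * psi C f Z Y $ j)) \<partial>lborel))"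

text \<open>The values of \<^const>\<open>T0\<close> are formally complex; a fixed point is real-valued.\<close>

definition T0_fixed_point :: "(real^3) set \<Rightarrow> 'm::finite numbering \<Rightarrow> real^('m idx)^'m \<Rightarrow>
    (real^('m idx) \<Rightarrow> real^3 \<Rightarrow> real^'m) \<Rightarrow> (real^3 \<Rightarrow> real^'m) \<Rightarrow> (real^3 \<Rightarrow> real^'m) \<Rightarrow>
    real \<Rightarrow> (real^3 \<Rightarrow> real^('m idx)) \<Rightarrow> bool" where
  "T0_fixed_point \<Omega> \<sigma> C f A1 Ae \<epsilon> Z \<longleftrightarrow>
     (\<forall>X\<in>closure \<Omega>. \<forall>r. complex_of_real (Z X $ r) = T0 \<Omega> \<sigma> C f A1 Ae \<epsilon> Z X $ r)"

definition sup_norm :: "(real^3) set \<Rightarrow> (real^3 \<Rightarrow> real^'n::finite) \<Rightarrow> real" where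
  "sup_norm \<Omega> Z = Max (range (\<lambda>i. SUP X\<in>closure \<Omega>. \<bar>Z X $ i\<bar>))"

definition Omega_M :: "(real^3) set \<Rightarrow> real \<Rightarrow> (real^3 \<Rightarrow> real^'n::finite) set" where
  "Omega_M \<Omega> M = {Z. continuous_on (closure \<Omega>) Z \<and> sup_norm \<Omega> Z < M}"

definition set_plus :: "(real^3) set \<Rightarrow> (real^3 \<Rightarrow> real) \<Rightarrow> (real^3 \<Rightarrow> real) \<Rightarrow> (real^3) set" where
  "set_plus \<Omega> p q = {X \<in> closure \<Omega>. p X - q X \<ge> 0}"

definition set_minus :: "(real^3) set \<Rightarrow> (real^3 \<Rightarrow> real) \<Rightarrow> (real^3 \<Rightarrow> real) \<Rightarrow> (real^3) set" where
  "set_minus \<Omega> p q = {X \<in> closure \<Omega>. p X - q X < 0}"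

text \<open>Extended-real infimum, so that the distance to the empty set is \<open>\<infinity>\<close>.\<close>

definition edist_set :: "real^3 \<Rightarrow> (real^3) set \<Rightarrow> ereal" where
  "edist_set X S = (INF Y\<in>S. ereal (dist X Y))"

definition bdry_layer :: "(real^3) set \<Rightarrow> (real^3) set \<Rightarrow> real \<Rightarrow> (real^3) set" where
  "bdry_layer \<Omega> S d = {X \<in> closure \<Omega>. edist_set X (frontier S) \<le> ereal d}"

end

theory Submission
  imports Defs "HOL-Complex_Analysis.Great_Picard"
begin

text \<open>Cut the compact domain into finitely many pieces of small diameter. A piece on which a
  component of $Z_k - Z_l$ changes sign lies in the boundary layer, so the union of these pieces has
  small measure; on every other piece the integral of the absolute value is the absolute value of
  the integral. A diagonal subsequence along which all the integrals over pieces converge is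
  therefore Cauchy in $L^1$, and a further subsequence converges almost everywhere.\<close>

section \<open>Small partitions and almost everywhere convergence of a subsequence\<close>

text \<open>Total boundedness covers \<open>K\<close> by finitely many balls of radius
  \<open>e / 2\<close>. Making them disjoint one after the other keeps each piece Borel and inside
  its ball, hence of small diameter. The pieces are indexed by all naturals, with the covering ones
  below \<open>N\<close>.\<close>

lemma compact_small_partition:
  fixes K :: "'a::metric_space set"
  assumes "compact K" "e > 0"
  shows "\<exists>(D::nat \<Rightarrow> 'a set) N. disjoint_family D \<and> (\<forall>j. D j \<in> sets borel) \<and> K \<subseteq> (\<Union>j<N. D j) \<and>
    (\<forall>j. \<forall>x\<in>D j. \<forall>y\<in>D j. dist x y < e)"
proof -
  have "e / 2 > 0" using assms by simp
  then obtain S where S: "finite S" "K \<subseteq> (\<Union>x\<in>S. ball x (e/2))"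
    using compact_imp_seq_compact[OF assms(1), THEN seq_compact_imp_totally_bounded] by blast
  obtain c and N :: nat where c: "S = c ` {i. i < N}"
    using finite_imp_nat_seg_image_inj_on[OF S(1)] by metis
  define D where "D = disjointed (\<lambda>i. ball (c i) (e/2))"
  have sub: "D j \<subseteq> ball (c j) (e/2)" for j
    unfolding D_def by (rule disjointed_subset)
  have "dist x y < e" if "x \<in> D j" "y \<in> D j" for x y j
    using subsetD[OF sub[of j] that(1)] subsetD[OF sub[of j] that(2)] dist_triangle3[of x y "c j"]
    by simp
  moreover have "disjoint_family D"
    unfolding D_def by (rule disjoint_family_disjointed)
  moreover have "D j \<in> sets borel" for j
    unfolding D_def disjointed_def by auto
  moreover have "K \<subseteq> (\<Union>j<N. D j)"
    using S(2) finite_UN_disjointed_eq[where n=N and A="\<lambda>i. ball (c i) (e/2)"]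
    unfolding D_def c lessThan_atLeast0[symmetric] by (auto simp: lessThan_def)
  ultimately show ?thesis by (intro exI[of _ D] exI[of _ N]) auto
qed

text \<open>Cancellation inside a piece can occur only if \<open>w\<close> takes both signs there,
  and such a piece lies in \<open>L\<close>. Since the pieces are disjoint, their errors add up to
  at most the integral of the absolute value over \<open>L\<close>, whatever the number of
  pieces.\<close>

lemma (in finite_measure) integral_abs_le_sum_abs_integral:
  fixes w :: "'a \<Rightarrow> real" and D :: "nat \<Rightarrow> 'a set"
  assumes w: "integrable M w" and bound: "\<And>x. x \<in> space M \<Longrightarrow> \<bar>w x\<bar> \<le> B"
    and L: "L \<in> sets M"
    and D: "disjoint_family D" "\<And>j. D j \<inter> space M \<in> sets M" "space M \<subseteq> (\<Union>j<N. D j)"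
    and sign_change: "\<And>j x y. \<lbrakk>x \<in> D j \<inter> space M; y \<in> D j \<inter> space M; w x \<ge> 0; w y < 0\<rbrakk>
      \<Longrightarrow> D j \<inter> space M \<subseteq> L"
  shows "(LINT x|M. \<bar>w x\<bar>) \<le> (\<Sum>j<N. \<bar>LINT x|M. indicator (D j) x * w x\<bar>) + B * measure M L"
proof -
  have split: "(LINT x|M. g x) = (\<Sum>j<N. LINT x|M. indicator (D j) x * g x)"
    "\<And>j. integrable M (\<lambda>x. indicator (D j) x * g x)"
    if g: "integrable M g" for g :: "'a \<Rightarrow> real"
  proof -
    \<comment> \<open>Only the trace of \<open>D j\<close> on the space is assumed measurable, so
      integrability is obtained for the trace and transferred to \<open>D j\<close>, whose indicator
      agrees with it on \<open>space M\<close>.\<close>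
    have "integrable M (\<lambda>x. indicator (D j \<inter> space M) x * g x)" for j
      using integrable_mult_indicator[OF D(2) g] by simp
    moreover have "integrable M (\<lambda>x. indicator (D j) x * g x) \<longleftrightarrow>
        integrable M (\<lambda>x. indicator (D j \<inter> space M) x * g x)" for j
      by (intro Bochner_Integration.integrable_cong) (auto simp: indicator_def)
    ultimately show int: "\<And>j. integrable M (\<lambda>x. indicator (D j) x * g x)"
      by blast
    have "(\<Sum>j<N. indicator (D j) x * g x) = g x" if x: "x \<in> space M" for x
    proof -
      obtain i where i: "i < N" "x \<in> D i" using D(3) x by auto
      have "x \<notin> D j" if "j \<noteq> i" for j
        using D(1) i that by (auto simp: disjoint_family_on_def)
      then have "(\<Sum>j<N. indicator (D j) x * g x) = (\<Sum>j<N. if j = i then g x else 0)"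
        using i by (intro sum.cong) (auto simp: indicator_def)
      then show ?thesis using i by simp
    qed
    then have "(LINT x|M. g x) = (LINT x|M. (\<Sum>j<N. indicator (D j) x * g x))"
      by (intro Bochner_Integration.integral_cong) auto
    also have "\<dots> = (\<Sum>j<N. LINT x|M. indicator (D j) x * g x)"
      using int by (intro Bochner_Integration.integral_sum) auto
    finally show "(LINT x|M. g x) = (\<Sum>j<N. LINT x|M. indicator (D j) x * g x)" .
  qed
  have iL: "integrable M (\<lambda>x. indicator L x * \<bar>w x\<bar>)"
    using integrable_mult_indicator[OF L integrable_abs[OF w]] by simp
  have iw: "integrable M (\<lambda>x. \<bar>w x\<bar>)" using w by simp
  \<comment> \<open>One bound serves every kind of piece: the first term is sharp when
    \<open>w\<close> has constant sign, the second when the piece lies in \<open>L\<close>. The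
    factor \<open>indicator (D j)\<close> stays in the second term so that summing over
    \<open>j\<close> reassembles a single integral over \<open>L\<close>.\<close>
  have piece: "(LINT x|M. indicator (D j) x * \<bar>w x\<bar>) \<le>
      \<bar>LINT x|M. indicator (D j) x * w x\<bar> + (LINT x|M. indicator (D j) x * (indicator L x * \<bar>w x\<bar>))"
    for j
  proof -
    have nn: "0 \<le> (LINT x|M. indicator (D j) x * (indicator L x * \<bar>w x\<bar>))"
      by (intro integral_nonneg_AE) (auto simp: indicator_def)
    consider "\<forall>x\<in>D j \<inter> space M. w x \<ge> 0" | "\<forall>x\<in>D j \<inter> space M. w x < 0" | "D j \<inter> space M \<subseteq> L"
      using sign_change[of _ j] by (meson not_less)
    then show ?thesis
    proof cases
      case 1
      then have "(LINT x|M. indicator (D j) x * \<bar>w x\<bar>) = (LINT x|M. indicator (D j) x * w x)"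
        by (intro Bochner_Integration.integral_cong) (auto simp: indicator_def)
      then show ?thesis using nn by linarith
    next
      case 2
      then have "(LINT x|M. indicator (D j) x * \<bar>w x\<bar>) = (LINT x|M. - (indicator (D j) x * w x))"
        by (intro Bochner_Integration.integral_cong) (auto simp: indicator_def abs_of_neg)
      also have "\<dots> = - (LINT x|M. indicator (D j) x * w x)" by simp
      finally show ?thesis using nn by linarith
    next
      case 3
      then have "(LINT x|M. indicator (D j) x * \<bar>w x\<bar>) =
          (LINT x|M. indicator (D j) x * (indicator L x * \<bar>w x\<bar>))"
        by (intro Bochner_Integration.integral_cong) (auto simp: indicator_def)
      then show ?thesis by linarith
    qed
  qed
  have "(LINT x|M. \<bar>w x\<bar>) \<le> (\<Sum>j<N. \<bar>LINT x|M. indicator (D j) x * w x\<bar>) +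
      (LINT x|M. indicator L x * \<bar>w x\<bar>)"
    unfolding split(1)[OF iw] split(1)[OF iL] sum.distrib[symmetric]
    by (intro sum_mono piece)
  also have "(LINT x|M. indicator L x * \<bar>w x\<bar>) \<le> (LINT x|M. indicator L x * B)"
  proof (rule integral_mono[OF iL])
    show "integrable M (\<lambda>x. indicator L x * B)"
      using integrable_mult_indicator[OF L, of "\<lambda>_. B"] by simp
  qed (auto simp: indicator_def intro: bound)
  also have "(LINT x|M. indicator L x * B) = (LINT x|M. indicator L x) * B"
    by (rule integral_mult_left_zero)
  also have "(LINT x|M. indicator L x) = measure M L"
    using L sets.sets_into_space[OF L] by (simp add: Int_absorb2)
  finally show ?thesis by (simp add: mult.commute)
qed

text \<open>This separates the measure theory from the boundary layers. In \<open>thin\<close> the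
  exceptional set \<open>L\<close> may depend on \<open>k\<close>, \<open>l\<close> and
  \<open>i\<close>, but \<open>d\<close> may not: one partition of mesh below \<open>d\<close> then
  serves all pairs of functions at once.\<close>

lemma AE_convergent_subseq_of_thin_sign_changes:
  fixes M :: "'a::metric_space measure" and u :: "nat \<Rightarrow> 'a \<Rightarrow> real^'n"
  assumes M: "finite_measure M"
    and K: "compact K" "sets M = sets (restrict_space borel K)"
    and meas: "\<And>k. u k \<in> borel_measurable M"
    and bound: "\<And>k x i. x \<in> K \<Longrightarrow> \<bar>u k x $ i\<bar> \<le> B" "B > 0"
    and thin: "\<And>c. c > 0 \<Longrightarrow> \<exists>d>0. \<forall>k l i. \<exists>L\<in>sets M. measure M L \<le> c \<and>
      (\<forall>D\<subseteq>K. (\<forall>x\<in>D. \<forall>y\<in>D. dist x y < d) \<longrightarrow>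
        (\<exists>x\<in>D. u k x $ i \<ge> u l x $ i) \<longrightarrow> (\<exists>y\<in>D. u k y $ i < u l y $ i) \<longrightarrow> D \<subseteq> L)"
  shows "\<exists>r. strict_mono r \<and> (AE x in M. convergent (\<lambda>k. u (r k) x))"
proof -
  interpret finite_measure M by (rule M)
  have space: "space M = K"
    using sets_eq_imp_space_eq[OF K(2)] by (simp add: space_restrict_space)
  \<comment> \<open>One partition is fixed for each mesh \<open>inverse (Suc n)\<close> before any
    subsequence is chosen, so that countably many integrals suffice for all values of
    \<open>d\<close> that arise later.\<close>
  define P where "P n D N \<longleftrightarrow> disjoint_family D \<and> (\<forall>j. D j \<in> sets borel) \<and>
      K \<subseteq> (\<Union>j<N. D j) \<and> (\<forall>j. \<forall>x\<in>D j. \<forall>y\<in>D j. dist x y < inverse (Suc n))"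
    for n :: nat and D :: "nat \<Rightarrow> 'a set" and N
  have "\<exists>D N. P n D N" for n
    unfolding P_def by (intro compact_small_partition K(1)) simp
  then obtain D N where "\<And>n. P n (D n) (N n)" by metis
  then have D: "\<And>n. disjoint_family (D n)" "\<And>n j. D n j \<in> sets borel"
      "\<And>n. K \<subseteq> (\<Union>j<N n. D n j)"
      "\<And>n j x y. x \<in> D n j \<Longrightarrow> y \<in> D n j \<Longrightarrow> dist x y < inverse (Suc n)"
    unfolding P_def by blast+
  have DM: "D n j \<inter> space M \<in> sets M" for n j
    unfolding K(2) space by (auto simp: sets_restrict_space D(2))
  have comp [measurable]: "(\<lambda>x. u k x $ i) \<in> borel_measurable M" for k i
    by (intro borel_measurable_continuous_on[OF _ meas] continuous_intros)
  have iu: "integrable M (\<lambda>x. u k x $ i)" for k i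
    by (rule integrable_const_bound[where B=B]) (auto simp: space bound)
  have iDu: "integrable M (\<lambda>x. indicator (D n j) x * u k x $ i)" for k i n j
  proof -
    have "integrable M (\<lambda>x. indicator (D n j \<inter> space M) x * u k x $ i)"
      using integrable_mult_indicator[OF DM iu] by simp
    then show ?thesis
      by (rule iffD1[OF Bochner_Integration.integrable_cong, rotated 2]) (auto simp: indicator_def)
  qed
  define I where "I k p = (case p of (n, j, i) \<Rightarrow> LINT x|M. indicator (D n j) x * u k x $ i)"
    for k and p :: "nat \<times> nat \<times> 'n"
  have I_bound: "norm (I k p) \<le> B * measure M (space M)" for k p
  proof (cases p)
    case (fields n j i)
    have "norm (I k p) \<le> (LINT x|M. norm (indicator (D n j) x * u k x $ i))"
      unfolding I_def fields by (simp only: prod.case) (rule integral_norm_bound)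
    also have "\<dots> \<le> (LINT x|M. B)"
    proof (rule integral_mono)
      show "norm (indicator (D n j) x * u k x $ i) \<le> B" if "x \<in> space M" for x
        using that bound(1)[of x k i] bound(2) by (auto simp: indicator_def space)
    qed (use iDu in auto)
    finally show ?thesis by (simp add: mult.commute)
  qed
  \<comment> \<open>The diagonal argument: the \<open>I k\<close> are uniformly bounded functions on
    a countable set, whose points consist of mesh, piece and component, so a subsequence converges
    at every point.\<close>
  obtain r where r: "strict_mono (r::nat\<Rightarrow>nat)" "\<And>p. \<exists>l. (\<lambda>k. I (r k) p) \<longlonglongrightarrow> l"
  proof (rule function_convergent_subsequence[where f=I and S=UNIV])
    show "countable (UNIV :: (nat \<times> nat \<times> 'n) set)" by simp
    show "norm (I k p) \<le> B * measure M (space M)" for k p by (rule I_bound)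
  qed (use that in simp)
  have Cauchy_comp: "\<exists>n0. \<forall>k\<ge>n0. \<forall>l\<ge>n0. (LINT x|M. \<bar>u (r k) x $ i - u (r l) x $ i\<bar>) < e"
    if "e > 0" for e i
  proof -
    \<comment> \<open>A difference of two members is bounded by \<open>2 * B\<close>, so an
      exceptional set of measure at most \<open>c\<close> contributes at most \<open>e / 2\<close>.
      The other half is left for the integrals over the pieces.\<close>
    define c where "c = e / (4 * B)"
    have c: "c > 0" "2 * B * c = e / 2" using that bound(2) by (auto simp: c_def)
    obtain d where d: "d > 0" and dL: "\<forall>k l i. \<exists>L\<in>sets M. measure M L \<le> c \<and>
      (\<forall>D\<subseteq>K. (\<forall>x\<in>D. \<forall>y\<in>D. dist x y < d) \<longrightarrow>
        (\<exists>x\<in>D. u k x $ i \<ge> u l x $ i) \<longrightarrow> (\<exists>y\<in>D. u k y $ i < u l y $ i) \<longrightarrow> D \<subseteq> L)"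
      using thin[OF c(1)] by (elim exE conjE) (rule that)
    obtain n where n: "inverse (Suc n) < d" using reals_Archimedean[OF d] by (elim exE) (rule that)
    define J where "J k l = (\<Sum>j<N n. \<bar>I (r k) (n, j, i) - I (r l) (n, j, i)\<bar>)" for k l
    have le: "(LINT x|M. \<bar>u (r k) x $ i - u (r l) x $ i\<bar>) \<le> J k l + e / 2" for k l
    proof -
      obtain L where L: "L \<in> sets M" "measure M L \<le> c"
        and bad: "\<forall>D\<subseteq>K. (\<forall>x\<in>D. \<forall>y\<in>D. dist x y < d) \<longrightarrow>
          (\<exists>x\<in>D. u (r k) x $ i \<ge> u (r l) x $ i) \<longrightarrow> (\<exists>y\<in>D. u (r k) y $ i < u (r l) y $ i) \<longrightarrow> D \<subseteq> L"
        using dL[rule_format, where k="r k" and l="r l" and i=i] by (elim bexE conjE) (rule that)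
      have "(LINT x|M. \<bar>u (r k) x $ i - u (r l) x $ i\<bar>) \<le>
          (\<Sum>j<N n. \<bar>LINT x|M. indicator (D n j) x * (u (r k) x $ i - u (r l) x $ i)\<bar>)
          + (2 * B) * measure M L"
      proof (rule integral_abs_le_sum_abs_integral)
        show "\<bar>u (r k) x $ i - u (r l) x $ i\<bar> \<le> 2 * B" if "x \<in> space M" for x
          using bound(1)[of x "r k" i] bound(1)[of x "r l" i] that by (auto simp: space)
        show "D n j \<inter> space M \<subseteq> L" if "x \<in> D n j \<inter> space M" "y \<in> D n j \<inter> space M"
          "u (r k) x $ i - u (r l) x $ i \<ge> 0" "u (r k) y $ i - u (r l) y $ i < 0" for j x y
        proof (rule bad[rule_format])
          show "dist x y < d" if "x \<in> D n j \<inter> space M" "y \<in> D n j \<inter> space M" for x y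
            using D(4)[of x n j y] that n by auto
          show "\<exists>x\<in>D n j \<inter> space M. u (r l) x $ i \<le> u (r k) x $ i"
            using that(1,3) by (intro bexI[of _ x]) auto
          show "\<exists>x\<in>D n j \<inter> space M. u (r k) x $ i < u (r l) x $ i"
            using that(2,4) by (intro bexI[of _ y]) auto
        qed (auto simp: space)
      qed (use iu L DM D space in auto)
      also have "(\<Sum>j<N n. \<bar>LINT x|M. indicator (D n j) x * (u (r k) x $ i - u (r l) x $ i)\<bar>) = J k l"
        unfolding J_def I_def by (simp add: right_diff_distrib iDu)
      also have "(2 * B) * measure M L \<le> (2 * B) * c"
        using L bound(2) by (intro mult_left_mono) auto
      finally show ?thesis using c by simp
    qed
    \<comment> \<open>The mesh index \<open>n\<close> is now fixed, so only the \<open>N n\<close>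
      convergent sequences of integrals matter. Adding 1 in the denominator keeps it nonzero if
      \<open>N n = 0\<close> and makes the summed bound strictly less than
      \<open>e / 2\<close>.\<close>
    have "\<exists>n1. \<forall>j<N n. \<forall>k\<ge>n1. \<forall>l\<ge>n1.
        \<bar>I (r k) (n, j, i) - I (r l) (n, j, i)\<bar> < e / (2 * (real (N n) + 1))"
    proof -
      have "\<exists>n1. \<forall>k\<ge>n1. \<forall>l\<ge>n1. \<bar>I (r k) (n, j, i) - I (r l) (n, j, i)\<bar> < e / (2 * (real (N n) + 1))" for j
        using convergent_Cauchy[of "\<lambda>k. I (r k) (n, j, i)"] r(2)[of "(n, j, i)"] that
        unfolding convergent_def Cauchy_def dist_real_def by (auto simp: add_pos_nonneg)
      then obtain n1 where n1: "\<And>j k l. \<lbrakk>k \<ge> n1 j; l \<ge> n1 j\<rbrakk> \<Longrightarrow>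
          \<bar>I (r k) (n, j, i) - I (r l) (n, j, i)\<bar> < e / (2 * (real (N n) + 1))"
        by metis
      have "n1 j \<le> Max (insert 0 (n1 ` {..<N n}))" if "j < N n" for j
        using that by (intro Max_ge) auto
      then show ?thesis
        using n1 by (meson order_trans)
    qed
    then obtain n1 where n1: "\<And>j k l. \<lbrakk>j < N n; k \<ge> n1; l \<ge> n1\<rbrakk> \<Longrightarrow>
        \<bar>I (r k) (n, j, i) - I (r l) (n, j, i)\<bar> < e / (2 * (real (N n) + 1))"
      by blast
    have J_less: "J k l < e / 2" if kl: "k \<ge> n1" "l \<ge> n1" for k l
    proof -
      have "J k l \<le> real (card {..<N n}) * (e / (2 * (real (N n) + 1)))"
        unfolding J_def using n1[OF _ kl] by (intro sum_bounded_above less_imp_le) auto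
      also have "\<dots> < e / 2" using \<open>e > 0\<close> by (simp add: field_simps)
      finally show ?thesis .
    qed
    show ?thesis
    proof (intro exI allI impI)
      show "(LINT x|M. \<bar>u (r k) x $ i - u (r l) x $ i\<bar>) < e" if "k \<ge> n1" "l \<ge> n1" for k l
        using le[of k l] J_less[OF that] by linarith
    qed
  qed
  have L1: "\<exists>n0. \<forall>k\<ge>n0. \<forall>l\<ge>n0. (LINT x|M. norm (u (r k) x - u (r l) x)) < e" if "e > 0" for e
  proof -
    \<comment> \<open>The Euclidean norm is at most the sum of the absolute components, so each
      component gets an equal share of \<open>e\<close>. The maximum of the thresholds exists
      because there are finitely many components.\<close>
    define e' where "e' = e / CARD('n)"
    have "e' > 0" using that by (simp add: e'_def)
    then obtain n0 where n0: "\<And>i k l. \<lbrakk>k \<ge> n0 i; l \<ge> n0 i\<rbrakk> \<Longrightarrow>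
        (LINT x|M. \<bar>u (r k) x $ i - u (r l) x $ i\<bar>) < e'"
      using Cauchy_comp by metis
    have "(LINT x|M. norm (u (r k) x - u (r l) x)) < e"
      if kl: "k \<ge> Max (range n0)" "l \<ge> Max (range n0)" for k l
    proof -
      have "(LINT x|M. norm (u (r k) x - u (r l) x)) \<le>
          (LINT x|M. (\<Sum>i\<in>UNIV. \<bar>u (r k) x $ i - u (r l) x $ i\<bar>))"
        using norm_le_l1_cart[of "u (r k) x - u (r l) x" for x] iu
        by (intro integral_mono') (auto simp: sum_nonneg)
      also have "\<dots> = (\<Sum>i\<in>UNIV. LINT x|M. \<bar>u (r k) x $ i - u (r l) x $ i\<bar>)"
        using iu by (intro Bochner_Integration.integral_sum) auto
      also have "\<dots> < (\<Sum>i\<in>(UNIV::'n set). e')"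
        using kl by (intro sum_strict_mono n0) auto
      finally show ?thesis by (simp add: e'_def)
    qed
    then show ?thesis by blast
  qed
  have iur: "integrable M (u (r k))" for k
  proof (rule integrable_const_bound)
    show "AE x in M. norm (u (r k) x) \<le> real CARD('n) * B"
    proof (intro AE_I2)
      fix x assume "x \<in> space M"
      then have "(\<Sum>i\<in>UNIV. \<bar>u (r k) x $ i\<bar>) \<le> real CARD('n) * B"
        by (intro sum_bounded_above) (auto simp: space bound)
      then show "norm (u (r k) x) \<le> real CARD('n) * B"
        using norm_le_l1_cart[of "u (r k) x"] by linarith
    qed
  qed (rule meas)
  \<comment> \<open>A Cauchy sequence in L1 has a subsequence that is pointwise Cauchy almost
    everywhere; completeness of the target space then gives convergence.\<close>
  obtain s where s: "strict_mono s" "AE x in M. Cauchy (\<lambda>k. u (r (s k)) x)"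
    by (rule cauchy_L1_AE_cauchy_subseq[of M "\<lambda>k. u (r k)", OF iur L1])
  have "strict_mono (r \<circ> s)" using r(1) s(1) by (rule strict_mono_o)
  then show ?thesis
    using s(2) by (intro exI[of _ "r \<circ> s"]) (auto simp: Cauchy_convergent_iff)
qed

section \<open>Boundary layers and the bound on components\<close>

text \<open>An infimum is below \<open>y\<close> exactly when some member is, so each strict
  sublevel set is a union of open sets. This works for every \<open>S\<close>, including the empty
  set, where the distance is infinite and the union is empty.\<close>

lemma edist_set_measurable [measurable]: "(\<lambda>X. edist_set X S) \<in> borel_measurable borel"
proof (rule borel_measurableI_less)
  fix y
  have "{X \<in> space borel. edist_set X S < y} = (\<Union>Y\<in>S. {X. ereal (dist X Y) < y})"
    by (auto simp: edist_set_def INF_less_iff)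
  moreover have "open {X. ereal (dist X Y) < y}" for Y
    by (intro open_Collect_less continuous_intros)
  ultimately show "{X \<in> space borel. edist_set X S < y} \<in> sets borel"
    by (simp only:) (intro borel_open open_UN ballI)
qed

lemma bdry_layer_measurable: "bdry_layer \<Omega> S d \<in> sets borel"
proof -
  have "bdry_layer \<Omega> S d = closure \<Omega> \<inter> {X \<in> space borel. edist_set X (frontier S) \<le> ereal d}"
    by (auto simp: bdry_layer_def)
  also have "\<dots> \<in> sets borel" by measurable
  finally show ?thesis .
qed

text \<open>The segment between two points on different sides of \<open>S\<close> meets \<open>frontier S\<close>.\<close>

lemma subset_bdry_layer:
  assumes D: "D \<subseteq> closure \<Omega>" "\<And>X Y. \<lbrakk>X \<in> D; Y \<in> D\<rbrakk> \<Longrightarrow> dist X Y < d"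
    and "D \<inter> S \<noteq> {}" "D - S \<noteq> {}"
  shows "D \<subseteq> bdry_layer \<Omega> S d"
proof
  fix X assume X: "X \<in> D"
  obtain Y where Y: "Y \<in> D" "X \<in> S \<longleftrightarrow> Y \<notin> S"
    using assms(3,4) by blast
  have "closed_segment X Y \<inter> frontier S \<noteq> {}"
    using Y(2) by (intro connected_Int_frontier) auto
  then obtain W where W: "W \<in> closed_segment X Y" "W \<in> frontier S" by blast
  \<comment> \<open>A point of the segment is no farther from \<open>X\<close> than the other
    endpoint \<open>Y\<close>.\<close>
  have "dist X W \<le> d"
    using D(2)[OF X Y(1)] dist_in_closed_segment(1)[OF W(1)] by (simp add: dist_commute)
  then have "edist_set X (frontier S) \<le> ereal d"
    unfolding edist_set_def using W(2) by (intro INF_lower2) auto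
  then show "X \<in> bdry_layer \<Omega> S d"
    using X D(1) by (auto simp: bdry_layer_def)
qed

text \<open>A real supremum dominates the values only when they are bounded above; continuity on the
  compact closure supplies this.\<close>

lemma Omega_M_component_less:
  assumes "bounded \<Omega>" "Z \<in> Omega_M \<Omega> M" "X \<in> closure \<Omega>"
  shows "\<bar>Z X $ i\<bar> < M"
proof -
  have cont: "continuous_on (closure \<Omega>) (\<lambda>X. \<bar>Z X $ i\<bar>)"
    using assms(2) by (auto simp: Omega_M_def intro!: continuous_intros)
  have "bdd_above ((\<lambda>X. \<bar>Z X $ i\<bar>) ` closure \<Omega>)"
    using compact_continuous_image[OF cont] assms(1)
    by (simp add: compact_closure compact_imp_bounded bounded_imp_bdd_above)
  then have "\<bar>Z X $ i\<bar> \<le> (SUP X\<in>closure \<Omega>. \<bar>Z X $ i\<bar>)"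
    using assms(3) by (rule cSUP_upper[rotated])
  also have "\<dots> \<le> sup_norm \<Omega> Z"
    unfolding sup_norm_def by (intro Max_ge) auto
  also have "\<dots> < M" using assms(2) by (simp add: Omega_M_def)
  finally show ?thesis .
qed

section \<open>Selecting the convergent subsequence of fixed points\<close>

theorem theorem4p4:
  fixes \<Omega> :: "(real^3) set" and \<alpha> :: real
    and \<sigma> :: "'m::finite numbering"
    and C :: "real^('m idx)^'m"
    and f :: "real^('m idx) \<Rightarrow> real^3 \<Rightarrow> real^'m"
    and A1 Ae :: "real^3 \<Rightarrow> real^'m"
    and M :: real
    and \<epsilon> :: "nat \<Rightarrow> real"
    and Z :: "nat \<Rightarrow> real^3 \<Rightarrow> real^('m idx)"
  assumes domain: "open \<Omega>" "connected \<Omega>" "\<Omega> \<noteq> {}" "bounded \<Omega>" "convex (closure \<Omega>)"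
    and boundary: "0 < \<alpha>" "\<alpha> \<le> 1" "C1_holder_boundary \<alpha> \<Omega>"
    and permutation: "bij \<sigma>"
    and f_cont: "continuous_on (UNIV \<times> closure \<Omega>) (\<lambda>(z, X). f z X)"
    and C_adm: "admissible_C \<sigma> C"
    and datum: "Ck_surface 2 (frontier \<Omega>) A1"
    and extension: "Ck_extension 1 (frontier \<Omega>) A1 Ae"
    and g02_exists: "\<forall>P0\<in>frontier \<Omega>. \<exists>l. (inner_normal_deriv \<Omega> A1 P0 \<longlongrightarrow> l) (at_right 0)"
    and g02_C1: "Ck_surface 1 (frontier \<Omega>) (g02 \<Omega> A1)"
    and M_pos: "M > 0"
    and eps: "\<forall>k. \<epsilon> k > 0" "\<epsilon> \<longlonglongrightarrow> 0"
    and Z_in: "\<forall>k. Z k \<in> Omega_M \<Omega> M"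
    and Z_fix: "\<forall>k. T0_fixed_point \<Omega> \<sigma> C f A1 Ae (\<epsilon> k) (Z k)"
    and layers: "\<forall>c>0. \<exists>d>0. \<forall>k l i.
        emeasure lebesgue
          (bdry_layer \<Omega> (set_plus \<Omega> (\<lambda>X. Z k X $ i) (\<lambda>X. Z l X $ i)) d \<union>
           bdry_layer \<Omega> (set_minus \<Omega> (\<lambda>X. Z k X $ i) (\<lambda>X. Z l X $ i)) d) \<le> ennreal c"
  shows "\<exists>(\<epsilon>'::nat \<Rightarrow> real) (Z'::nat \<Rightarrow> real^3 \<Rightarrow> real^('m idx)).
           (\<forall>k. \<epsilon>' k > 0 \<and> Z' k \<in> Omega_M \<Omega> M \<and> T0_fixed_point \<Omega> \<sigma> C f A1 Ae (\<epsilon>' k) (Z' k)) \<and>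
           \<epsilon>' \<longlonglongrightarrow> 0 \<and>
           (AE X in lebesgue. X \<in> closure \<Omega> \<longrightarrow> convergent (\<lambda>k. Z' k X))"
proof -
  \<comment> \<open>Starting from \<open>lborel\<close> makes the measurable sets of
    \<open>?N\<close> the Borel sets of the closure, so continuity there yields measurability. The
    passage to \<open>lebesgue\<close> comes at the end.\<close>
  let ?K = "closure \<Omega>" and ?N = "restrict_space lborel (closure \<Omega>)"
  have K: "compact ?K" using domain(4) by (simp add: compact_closure)
  have sets_N: "sets ?N = sets (restrict_space borel ?K)"
    by (simp add: sets_restrict_space)
  have "finite_measure ?N"
    using emeasure_compact_finite[OF K]
    by (intro finite_measureI) (simp add: emeasure_restrict_space space_restrict_space)
  then have "\<exists>r. strict_mono r \<and> (AE X in ?N. convergent (\<lambda>k. Z (r k) X))"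
  proof (rule AE_convergent_subseq_of_thin_sign_changes[OF _ K sets_N])
    show "Z k \<in> borel_measurable ?N" for k
    proof -
      have "continuous_on ?K (Z k)" using Z_in by (simp add: Omega_M_def)
      then show ?thesis
        using borel_measurable_continuous_on_restrict measurable_cong_sets[OF sets_N refl] by blast
    qed
    show "\<bar>Z k X $ i\<bar> \<le> M" if "X \<in> ?K" for k X i
      using Omega_M_component_less[OF domain(4) _ that] Z_in by (meson less_imp_le)
    show "\<exists>d>0. \<forall>k l i. \<exists>L\<in>sets ?N. measure ?N L \<le> c \<and>
      (\<forall>D\<subseteq>?K. (\<forall>x\<in>D. \<forall>y\<in>D. dist x y < d) \<longrightarrow>
        (\<exists>x\<in>D. Z k x $ i \<ge> Z l x $ i) \<longrightarrow> (\<exists>y\<in>D. Z k y $ i < Z l y $ i) \<longrightarrow> D \<subseteq> L)"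
      if "c > 0" for c
    proof -
      define S where "S k l i = set_plus \<Omega> (\<lambda>X. Z k X $ i) (\<lambda>X. Z l X $ i)" for k l i
      define S' where "S' k l i = set_minus \<Omega> (\<lambda>X. Z k X $ i) (\<lambda>X. Z l X $ i)" for k l i
      obtain d where d: "d > 0" and le: "\<And>k l i. emeasure lebesgue
          (bdry_layer \<Omega> (S k l i) d \<union> bdry_layer \<Omega> (S' k l i) d) \<le> ennreal c"
        using layers \<open>c > 0\<close> unfolding S_def S'_def by blast
      have "\<exists>L\<in>sets ?N. measure ?N L \<le> c \<and>
        (\<forall>D\<subseteq>?K. (\<forall>x\<in>D. \<forall>y\<in>D. dist x y < d) \<longrightarrow>
          (\<exists>x\<in>D. Z k x $ i \<ge> Z l x $ i) \<longrightarrow> (\<exists>y\<in>D. Z k y $ i < Z l y $ i) \<longrightarrow> D \<subseteq> L)" for k l i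
      \<comment> \<open>Within the closure, \<open>S k l i\<close> is exactly where the difference
        is nonnegative. A set on which both signs occur thus meets both \<open>S k l i\<close> and
        its complement, and if its diameter is small it lies in the layer of \<open>S k l i\<close>.
        The measure of this layer is at most that of the union in the hypothesis.\<close>
      proof (intro bexI[of _ "bdry_layer \<Omega> (S k l i) d"] conjI allI impI)
        have sub: "bdry_layer \<Omega> (S k l i) d \<subseteq> ?K" by (auto simp: bdry_layer_def)
        show "bdry_layer \<Omega> (S k l i) d \<in> sets ?N"
          using sub bdry_layer_measurable by (auto simp: sets_restrict_space)
        have "emeasure ?N (bdry_layer \<Omega> (S k l i) d) = emeasure lebesgue (bdry_layer \<Omega> (S k l i) d)"
          using sub bdry_layer_measurable by (simp add: emeasure_restrict_space)
        also have "\<dots> \<le> emeasure lebesgue (bdry_layer \<Omega> (S k l i) d \<union> bdry_layer \<Omega> (S' k l i) d)"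
          by (intro emeasure_mono) (auto intro!: bdry_layer_measurable sets.Un sets_completionI_sets)
        also note le
        finally show "measure ?N (bdry_layer \<Omega> (S k l i) d) \<le> c"
          using \<open>c > 0\<close> by (simp add: measure_def enn2real_leI)
        show "D \<subseteq> bdry_layer \<Omega> (S k l i) d"
          if "D \<subseteq> ?K" "\<forall>x\<in>D. \<forall>y\<in>D. dist x y < d" "\<exists>x\<in>D. Z k x $ i \<ge> Z l x $ i"
            "\<exists>y\<in>D. Z k y $ i < Z l y $ i" for D
        proof (rule subset_bdry_layer)
          show "D \<inter> S k l i \<noteq> {}" using that(1,3) by (auto simp: S_def set_plus_def)
          show "D - S k l i \<noteq> {}" using that(1,4) by (force simp: S_def set_plus_def)
        qed (use that in auto)
      qed
      then show ?thesis using d by blast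
    qed
  qed (rule M_pos)
  then obtain r where r: "strict_mono r" "AE X in ?N. convergent (\<lambda>k. Z (r k) X)" by blast
  \<comment> \<open>Restriction to the closure becomes an implication under \<open>lborel\<close>,
    and an almost everywhere statement survives completion of the measure.\<close>
  have "AE X in lebesgue. X \<in> ?K \<longrightarrow> convergent (\<lambda>k. Z (r k) X)"
    using r(2) by (intro AE_completion) (simp add: AE_restrict_space_iff)
  moreover have "(\<lambda>k. \<epsilon> (r k)) \<longlonglongrightarrow> 0"
    using LIMSEQ_subseq_LIMSEQ[OF eps(2) r(1)] by (simp add: o_def)
  ultimately show ?thesis
    using eps(1) Z_in Z_fix by (intro exI[of _ "\<lambda>k. \<epsilon> (r k)"] exI[of _ "\<lambda>k. Z (r k)"]) auto
qed

end
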